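(* Let $\mathcal{L}=(L,\wedge,\vee,\otimes,0,1)$ be an integral $\ell$-monoid, let $\alpha$ be an arbitrary fuzzy regular expression over a finite alphabet $X$, and let $Y$ be an alphabet associated with $\alpha$. For an arbitrary nondeterministic (finite) automaton $\mathcal A=(A,X\cup Y,\delta^A,a_0,\tau^A)$ recognizing the language $\|\alpha_R\|$ and the fuzzy automaton $\mathcal A_\alpha=(A_\alpha,X,\delta^{A_\alpha},a_0,\tau^{A_\alpha})$ associated with $\mathcal A$ and $\alpha$ we have $$\delta^{A_\alpha}_x=R_{\mathcal A}\circ\delta^A_x\circ R_{\mathcal A}\quad\text{for every }x\in X,\qquad\text{and}\qquad \tau^{A_\alpha}=R_{\mathcal A}\circ\tau^A.$$
   Context: **Integral $\ell$-monoid.** An algebra $(L,\wedge,\vee,\otimes,0,1)$ such that $(L,\wedge,\vee,0,1)$ is a lattice with least element $0$ and greatest element $1$ (not necessarily complete), $(L,\otimes,1)$ is a (not necessarily commutative) monoid whose unit is the greatest element $1$, $x\otimes 0=0\otimes x=0$, $x\otimes(y\vee z)=(x\otimes y)\vee(x\otimes z)$ and $(x\vee y)\otimes z=(x\otimes z)\vee(y\otimes z)$ for all $x,y,z\in L$. **Fuzzy regular expressions** over a finite alphabet $X$ are defined inductively: $\emptyset$, $\varepsilon$ (empty word) and each $x\in X$ are fuzzy regular expressions; if $\alpha,\alpha_1,\alpha_2$ are, then so are $(\lambda\alpha)$ for $\lambda\in L$, $(\alpha_1+\alpha_2)$, $(\alpha_1\alpha_2)$ and $(\alpha^* )$. A regular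 expression is a fuzzy regular expression without scalars; its language $\|\cdot\|$ is the usual one, regarded as a $\{0,1\}$-valued function on words. **The regular expression $\alpha_R$.** Let $K\subseteq L$ be the (finite, possibly empty) set of scalars appearing in $\alpha$. An alphabet associated with $\alpha$ is a set $Y$ with $Y\cap X=\emptyset$ together with a bijection $K\to Y$, $\lambda\mapsto\lambda'$. Then $\alpha_R$ is the regular expression over $X\cup Y$ obtained from $\alpha$ by replacing each scalar $\lambda$ by the letter $\lambda'$ (so scalar multiplication by $\lambda$ becomes concatenation with $\lambda'$ on the left). The map $\varphi_\alpha^*:(X\cup Y)^*\to(L,\otimes,1)$ is the monoid homomorphism with $\varphi_\alpha^*(x)=1$ for $x\in X$ and $\varphi_\alpha^*(\lambda')=\lambda$ for $\lambda'\in Y$. **Automata.** A fuzzy automaton with a single crisp initial state is $\mathcal B=(B,Z,\delta^B,b_0,\tau^B)$ with $B$ a finite nonempty set, $Z$ a finite alphabet, $\delta^B:B\times Z\times B\to L$, $b_0\in B$, $\tau^B:B\to L$. The map $\delta^B$ is extended to $B\times Z^*\times B$ by $\delta^B(a,\varepsilon,b)=1$ if $a=b$ and $0$ otherwise, and $\delta^B(a,ux,b)=\bigvee_{c\in B}\delta^B(a,u,c)\otimes\delta^B(c,x,b)$; write $\delta^B_u(a,b)=\delta^B(a,u,b)$. Its language is $L(\mathcal B)(u)=\bigvee_{b\in B}\delta^B(b_0,u,b)\otimes\tau^B(b)$. It is a nondeterministic automaton if $\delta^B$ (on letters) and $\tau^B$ take values in $\{0,1\}$. **The fuzzy automaton $\mathcal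 A_\alpha$ associated with $\mathcal A$ and $\alpha$** has $A_\alpha=A$, initial state $a_0$, and for $a,b\in A$, $x\in X$, $$\delta^{A_\alpha}(a,x,b)=\bigvee_{v\in Y^*xY^*}\varphi_\alpha^*(v)\otimes\delta^A(a,v,b),\qquad \tau^{A_\alpha}(a)=\bigvee_{v\in Y^*}\bigvee_{b\in A}\varphi_\alpha^*(v)\otimes\delta^A(a,v,b)\otimes\tau^A(b)$$ (these suprema exist in $L$). **The fuzzy relation $R_{\mathcal A}$.** A fuzzy relation on $A$ is a map $A\times A\to L$, ordered pointwise; compositions are $(R\circ S)(a,b)=\bigvee_{c\in A}R(a,c)\otimes S(c,b)$ and, for $f:A\to L$, $(R\circ f)(a)=\bigvee_{b\in A}R(a,b)\otimes f(b)$; $R$ is transitive if $R(a,b)\otimes R(b,c)\le R(a,c)$ for all $a,b,c$. Define $R$ on $A$ by $R(a,a)=1$ and $R(a,b)=\bigvee_{\lambda'\in Y}\lambda\otimes\delta^A(a,\lambda',b)$ for $a\ne b$. Then $R_{\mathcal A}$ denotes the least transitive fuzzy relation on $A$ containing $R$; it equals $R^n=R\circ\cdots\circ R$ ($n$ factors), where $n=|A|$. *)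

theory Defs
  imports "HOL-Library.Cardinality"
begin

section \<open>Integral lattice-ordered monoids\<close>

class integral_l_monoid = lattice + monoid_mult + mult_zero +
  assumes zero_least: "0 \<le> x"
    and one_greatest: "x \<le> 1"
    and mult_sup_distrib: "x * sup y z = sup (x * y) (x * z)"
    and sup_mult_distrib: "sup x y * z = sup (x * z) (y * z)"

text \<open>
  The lattice need not be complete, so suprema are least upper bounds that have to be shown
  to exist. For finite sets they always do; for the infinite sets used below existence is
  proved at the end of this theory.
\<close>

definition is_lub :: "'l::order set \<Rightarrow> 'l \<Rightarrow> bool" where
  "is_lub S s \<longleftrightarrow> (\<forall>y\<in>S. y \<le> s) \<and> (\<forall>t. (\<forall>y\<in>S. y \<le> t) \<longrightarrow> s \<le> t)"

definition lsup :: "'l::order set \<Rightarrow> 'l" where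
  "lsup S = (LEAST s. \<forall>y\<in>S. y \<le> s)"


section \<open>Fuzzy relations\<close>

text \<open>
  A finite nonempty set of states is a type of class finite. Fuzzy relations are ordered by
  the pointwise order of the function space.
\<close>

type_synonym ('a, 'l) frel = "'a \<Rightarrow> 'a \<Rightarrow> 'l"

definition id_rel :: "('a, 'l::integral_l_monoid) frel" where
  "id_rel a b = (if a = b then 1 else 0)"

definition rel_comp :: "('a::finite, 'l::integral_l_monoid) frel \<Rightarrow> ('a, 'l) frel \<Rightarrow> ('a, 'l) frel"
    (infixl "\<odot>" 70) where
  "(R \<odot> S) a b = lsup {R a c * S c b | c. True}"

definition rel_app :: "('a::finite, 'l::integral_l_monoid) frel \<Rightarrow> ('a \<Rightarrow> 'l) \<Rightarrow> ('a \<Rightarrow> 'l)"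
    (infixr "\<odot>\<^sub>v" 70) where
  "(R \<odot>\<^sub>v f) a = lsup {R a b * f b | b. True}"

definition transitive_rel :: "('a, 'l::integral_l_monoid) frel \<Rightarrow> bool" where
  "transitive_rel R \<longleftrightarrow> (\<forall>a b c. R a b * R b c \<le> R a c)"

definition transitive_closure :: "('a, 'l::integral_l_monoid) frel \<Rightarrow> ('a, 'l) frel" where
  "transitive_closure R = (LEAST S. transitive_rel S \<and> R \<le> S)"


section \<open>Regular and fuzzy regular expressions\<close>

datatype (scalars: 'l, letters: 'z) fuzzy_rexp =
    FEmpty
  | FEps
  | FSym 'z
  | FScal 'l "('l, 'z) fuzzy_rexp"
  | FPlus "('l, 'z) fuzzy_rexp" "('l, 'z) fuzzy_rexp"
  | FConc "('l, 'z) fuzzy_rexp" "('l, 'z) fuzzy_rexp"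
  | FStar "('l, 'z) fuzzy_rexp"

datatype 'z rexp =
    Empty
  | Eps
  | Sym 'z
  | Plus "'z rexp" "'z rexp"
  | Conc "'z rexp" "'z rexp"
  | Star "'z rexp"

primrec lang :: "'z rexp \<Rightarrow> 'z list set" where
  "lang Empty = {}"
| "lang Eps = {[]}"
| "lang (Sym z) = {[z]}"
| "lang (Plus r s) = lang r \<union> lang s"
| "lang (Conc r s) = {u @ v | u v. u \<in> lang r \<and> v \<in> lang s}"
| "lang (Star r) = concat ` lists (lang r)"

definition char_lang :: "'z rexp \<Rightarrow> 'z list \<Rightarrow> 'l::integral_l_monoid" where
  "char_lang r u = (if u \<in> lang r then 1 else 0)"

text \<open>
  The bijection from scalars to letters is the function \<open>p\<close>, so that \<open>p l\<close> is the letter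
  written as \<open>l\<close> with a prime; only its values on the scalars of the expression matter.
\<close>

definition associated_alphabet ::
    "'z set \<Rightarrow> ('l, 'z) fuzzy_rexp \<Rightarrow> 'z set \<Rightarrow> ('l \<Rightarrow> 'z) \<Rightarrow> bool" where
  "associated_alphabet X \<alpha> Y p \<longleftrightarrow> Y \<inter> X = {} \<and> bij_betw p (scalars \<alpha>) Y"

primrec rexp_of :: "('l \<Rightarrow> 'z) \<Rightarrow> ('l, 'z) fuzzy_rexp \<Rightarrow> 'z rexp" where
  "rexp_of p FEmpty = Empty"
| "rexp_of p FEps = Eps"
| "rexp_of p (FSym z) = Sym z"
| "rexp_of p (FScal l r) = Conc (Sym (p l)) (rexp_of p r)"
| "rexp_of p (FPlus r s) = Plus (rexp_of p r) (rexp_of p s)"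
| "rexp_of p (FConc r s) = Conc (rexp_of p r) (rexp_of p s)"
| "rexp_of p (FStar r) = Star (rexp_of p r)"

definition phi :: "('l::integral_l_monoid, 'z) fuzzy_rexp \<Rightarrow> ('l \<Rightarrow> 'z) \<Rightarrow> 'z \<Rightarrow> 'l" where
  "phi \<alpha> p z = (if z \<in> p ` scalars \<alpha> then the_inv_into (scalars \<alpha>) p z else 1)"

definition phi_star :: "('l::integral_l_monoid, 'z) fuzzy_rexp \<Rightarrow> ('l \<Rightarrow> 'z) \<Rightarrow> 'z list \<Rightarrow> 'l" where
  "phi_star \<alpha> p v = prod_list (map (phi \<alpha> p) v)"


section \<open>Automata\<close>

text \<open>
  The transition function is stored as the family of relations \<open>delta B x\<close>, indexed by letters;
  values at letters outside the alphabet are irrelevant.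
\<close>

record ('a, 'z, 'l) fuzzy_automaton =
  alphabet :: "'z set"
  delta :: "'z \<Rightarrow> ('a, 'l) frel"
  init :: 'a
  final :: "'a \<Rightarrow> 'l"

text \<open>
  The left fold satisfies the recursion that splits off the last letter of a word; see
  \<open>delta_star_Nil\<close> and \<open>delta_star_snoc\<close> below.
\<close>

definition delta_star ::
    "('a::finite, 'z, 'l::integral_l_monoid) fuzzy_automaton \<Rightarrow> 'z list \<Rightarrow> ('a, 'l) frel" where
  "delta_star B u = foldl (\<lambda>R x. R \<odot> delta B x) id_rel u"

lemma delta_star_Nil: "delta_star B [] a b = (if a = b then 1 else 0)"
  by (simp add: delta_star_def id_rel_def)

lemma delta_star_snoc:
  "delta_star B (u @ [x]) a b = lsup {delta_star B u a c * delta B x c b | c. True}"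
  by (simp add: delta_star_def rel_comp_def)

definition language ::
    "('a::finite, 'z, 'l::integral_l_monoid) fuzzy_automaton \<Rightarrow> 'z list \<Rightarrow> 'l" where
  "language B u = lsup {delta_star B u (init B) b * final B b | b. True}"

definition nondeterministic ::
    "('a, 'z, 'l::integral_l_monoid) fuzzy_automaton \<Rightarrow> bool" where
  "nondeterministic B \<longleftrightarrow>
     (\<forall>x\<in>alphabet B. \<forall>a b. delta B x a b \<in> {0, 1}) \<and> (\<forall>a. final B a \<in> {0, 1})"

definition recognizes ::
    "('a::finite, 'z, 'l::integral_l_monoid) fuzzy_automaton \<Rightarrow> ('z list \<Rightarrow> 'l) \<Rightarrow> bool" where
  "recognizes B f \<longleftrightarrow> (\<forall>u\<in>lists (alphabet B). language B u = f u)"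

definition assoc_automaton ::
    "'z set \<Rightarrow> ('l::integral_l_monoid, 'z) fuzzy_rexp \<Rightarrow> 'z set \<Rightarrow> ('l \<Rightarrow> 'z) \<Rightarrow>
      ('a::finite, 'z, 'l) fuzzy_automaton \<Rightarrow> ('a, 'z, 'l) fuzzy_automaton" where
  "assoc_automaton X \<alpha> Y p A = \<lparr>
     alphabet = X,
     delta = (\<lambda>x a b. lsup {phi_star \<alpha> p v * delta_star A v a b | v.
                 \<exists>u\<in>lists Y. \<exists>w\<in>lists Y. v = u @ [x] @ w}),
     init = init A,
     final = (\<lambda>a. lsup {lsup {phi_star \<alpha> p v * delta_star A v a b * final A b | b. True} | v.
                 v \<in> lists Y})\<rparr>"

definition base_rel ::
    "('l::integral_l_monoid, 'z) fuzzy_rexp \<Rightarrow> ('l \<Rightarrow> 'z) \<Rightarrow>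
      ('a::finite, 'z, 'l) fuzzy_automaton \<Rightarrow> ('a, 'l) frel" where
  "base_rel \<alpha> p A a b =
     (if a = b then 1 else lsup {l * delta A (p l) a b | l. l \<in> scalars \<alpha>})"

definition closure_rel ::
    "('l::integral_l_monoid, 'z) fuzzy_rexp \<Rightarrow> ('l \<Rightarrow> 'z) \<Rightarrow>
      ('a::finite, 'z, 'l) fuzzy_automaton \<Rightarrow> ('a, 'l) frel" where
  "closure_rel \<alpha> p A = transitive_closure (base_rel \<alpha> p A)"


section \<open>Existence of the suprema and of the transitive closure\<close>

lemma lsup_eqI: "is_lub S s \<Longrightarrow> lsup S = s"
  unfolding lsup_def is_lub_def by (rule Least_equality) auto

lemma is_lub_finite:
  fixes T :: "'l::integral_l_monoid set"
  assumes "finite T"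
  shows "is_lub T (lsup T)"
proof -
  have "is_lub T (Sup_fin (insert 0 T))"
    unfolding is_lub_def using assms
    by (auto simp: Sup_fin.bounded_iff zero_least intro!: Sup_fin.coboundedI)
  then show ?thesis
    using lsup_eqI by metis
qed

lemma is_lub_dominated:
  fixes S :: "'l::integral_l_monoid set"
  assumes "finite T" "T \<subseteq> S" "\<And>s. s \<in> S \<Longrightarrow> \<exists>t\<in>T. s \<le> t"
  shows "is_lub S (lsup S)" and "lsup S = lsup T"
proof -
  have "is_lub S (lsup T)"
    using is_lub_finite[OF assms(1)] assms(2,3) unfolding is_lub_def
    by (meson order_trans subsetD)
  then show "lsup S = lsup T" "is_lub S (lsup S)"
    using lsup_eqI by metis+
qed

lemma mult_mono_lm:
  fixes x y :: "'l::integral_l_monoid"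
  assumes "x \<le> x'" "y \<le> y'"
  shows "x * y \<le> x' * y'"
proof -
  have "x * y \<le> x' * y"
    using assms(1) sup_mult_distrib[of x x' y] by (simp add: sup_absorb2 le_iff_sup)
  also have "\<dots> \<le> x' * y'"
    using assms(2) mult_sup_distrib[of x' y y'] by (simp add: sup_absorb2 le_iff_sup)
  finally show ?thesis .
qed

lemma mult_le_left: "x * y \<le> (x::'l::integral_l_monoid)"
  using mult_mono_lm[OF order_refl one_greatest, of x y] by simp

lemma mult_le_right: "x * y \<le> (y::'l::integral_l_monoid)"
  using mult_mono_lm[OF one_greatest order_refl, of x y] by simp

lemma lsup_insert:
  fixes T :: "'l::integral_l_monoid set"
  assumes "finite T"
  shows "lsup (insert t T) = sup t (lsup T)"
  by (rule lsup_eqI) (use is_lub_finite[OF assms] in \<open>auto simp: is_lub_def intro: le_supI2\<close>)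

lemma lsup_empty: "lsup {} = (0::'l::integral_l_monoid)"
  by (rule lsup_eqI) (auto simp: is_lub_def zero_least)

lemma lsup_mult_le:
  fixes T :: "'l::integral_l_monoid set"
  assumes "finite T" "\<And>t. t \<in> T \<Longrightarrow> t * z \<le> u"
  shows "lsup T * z \<le> u"
  using assms by (induction T) (auto simp: lsup_insert lsup_empty sup_mult_distrib zero_least)

lemma mult_lsup_le:
  fixes T :: "'l::integral_l_monoid set"
  assumes "finite T" "\<And>t. t \<in> T \<Longrightarrow> z * t \<le> u"
  shows "z * lsup T \<le> u"
  using assms by (induction T) (auto simp: lsup_insert lsup_empty mult_sup_distrib zero_least)

text \<open>Values of finite state sequences, used to construct the transitive closure.\<close>

primrec path_val :: "('a, 'l::integral_l_monoid) frel \<Rightarrow> 'a \<Rightarrow> 'a list \<Rightarrow> 'l" where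
  "path_val R a [] = 1"
| "path_val R a (c # cs) = R a c * path_val R c cs"

lemma path_val_append:
  "path_val R a (cs @ ds) = path_val R a cs * path_val R (last (a # cs)) ds"
  by (induction cs arbitrary: a) (auto simp: mult.assoc)

lemma path_val_shorten:
  fixes R :: "('a::finite, 'l::integral_l_monoid) frel"
  shows "\<exists>ds. length ds < CARD('a) \<and> last (a # ds) = last (a # cs)
           \<and> path_val R a cs \<le> path_val R a ds"
proof (induction cs rule: length_induct)
  case (1 cs)
  show ?case
  proof (cases "distinct (a # cs)")
    case True
    then have "length (a # cs) = card (set (a # cs))"
      by (rule distinct_card[symmetric])
    also have "\<dots> \<le> CARD('a)"
      by (rule card_mono) auto
    finally have "length (a # cs) \<le> CARD('a)" .
    then show ?thesis by (intro exI[of _ cs]) auto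
  next
    case False
    then obtain xs ys zs c where dec: "a # cs = xs @ [c] @ ys @ [c] @ zs"
      using not_distinct_decomp by blast
    obtain es where es: "length es < length cs" "last (a # es) = last (a # cs)"
      "path_val R a cs \<le> path_val R a es"
    proof (cases xs)
      case Nil
      then have *: "c = a" "cs = (ys @ [a]) @ zs" using dec by auto
      show ?thesis
        by (rule that[of zs]) (use * in \<open>simp_all only: path_val_append, auto intro: mult_le_right\<close>)
    next
      case (Cons b xs')
      then have *: "cs = (xs' @ [c]) @ (ys @ [c]) @ zs" using dec by auto
      have "path_val R a cs \<le> path_val R a ((xs' @ [c]) @ zs)"
        unfolding * path_val_append[of R a "xs' @ [c]"] path_val_append[of R _ "ys @ [c]"]
        by (intro mult_mono_lm order_refl) (auto intro: mult_le_right)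
      then show ?thesis by (intro that[of "(xs' @ [c]) @ zs"]) (use * in auto)
    qed
    from 1 es(1) obtain ds where "length ds < CARD('a)" "last (a # ds) = last (a # es)"
      "path_val R a es \<le> path_val R a ds" by blast
    then show ?thesis using es(2,3) by (intro exI[of _ ds]) (auto intro: order_trans)
  qed
qed

lemma transitive_closure_exists:
  fixes R :: "('a::finite, 'l::integral_l_monoid) frel"
  assumes refl: "\<And>a. R a a = 1"
  defines "C \<equiv> transitive_closure R"
  shows "transitive_rel C" and "R \<le> C"
    and "\<And>S. transitive_rel S \<Longrightarrow> R \<le> S \<Longrightarrow> C \<le> S"
proof -
  define V where "V a b = {path_val R a cs | cs. last (a # cs) = b}" for a b
  define T where
    "T a b = {path_val R a cs | cs. last (a # cs) = b \<and> length cs < CARD('a)}" for a b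
  define D where "D a b = lsup (V a b)" for a b
  have finT: "finite (T a b)" for a b
  proof -
    have "finite {cs::'a list. set cs \<subseteq> UNIV \<and> length cs \<le> CARD('a)}"
      by (intro finite_lists_length_le) auto
    then have "finite (path_val R a ` {cs::'a list. length cs \<le> CARD('a)})" by simp
    then show ?thesis by (rule rev_finite_subset) (unfold T_def, blast intro: less_imp_le)
  qed
  have sub: "T a b \<subseteq> V a b" for a b by (auto simp: T_def V_def)
  have dom: "\<exists>t\<in>T a b. s \<le> t" if s: "s \<in> V a b" for s a b
  proof -
    obtain cs where cs: "s = path_val R a cs" "last (a # cs) = b" using s by (auto simp: V_def)
    obtain ds where ds: "length ds < CARD('a)" "last (a # ds) = last (a # cs)"
      "path_val R a cs \<le> path_val R a ds" using path_val_shorten by blast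
    have "path_val R a ds \<in> T a b"
      unfolding T_def using cs(2) ds(1,2) by blast
    then show ?thesis using cs(1) ds(3) by blast
  qed
  have lub: "is_lub (V a b) (D a b)" and DT: "D a b = lsup (T a b)" for a b
    using is_lub_dominated[OF finT sub dom] unfolding D_def by auto
  have trD: "transitive_rel D"
    unfolding transitive_rel_def
  proof (intro allI)
    fix a b c
    have "t * s \<le> D a c" if t: "t \<in> T a b" and s: "s \<in> T b c" for t s
    proof -
      obtain cs ds where "t = path_val R a cs" "last (a # cs) = b"
          "s = path_val R b ds" "last (b # ds) = c"
        using t s by (auto simp: T_def)
      then have "t * s = path_val R a (cs @ ds)" "last (a # cs @ ds) = c"
        using path_val_append[of R a cs ds] by (auto split: if_splits)
      then have "t * s \<in> V a c" unfolding V_def by blast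
      then show ?thesis using lub by (auto simp: is_lub_def)
    qed
    then show "D a b * D b c \<le> D a c"
      unfolding DT[of a b] DT[of b c] by (intro lsup_mult_le mult_lsup_le finT)
  qed
  have RD: "R \<le> D"
  proof (intro le_funI)
    fix a b
    have "path_val R a [b] \<in> V a b" unfolding V_def by force
    then show "R a b \<le> D a b" using lub[of a b] by (auto simp: is_lub_def)
  qed
  have least: "D \<le> S" if S: "transitive_rel S" "R \<le> S" for S
  proof (intro le_funI)
    fix a b
    have one: "S c c = 1" for c
      using S(2) refl by (metis le_funD one_greatest order_antisym)
    have "path_val R a cs \<le> S a (last (a # cs))" for cs
    proof (induction cs arbitrary: a)
      case Nil
      then show ?case using one by simp
    next
      case (Cons c cs)
      have "R a c * path_val R c cs \<le> S a c * S c (last (c # cs))"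
        by (intro mult_mono_lm Cons le_funD[OF le_funD[OF S(2)]])
      also have "\<dots> \<le> S a (last (c # cs))" using S(1) by (auto simp: transitive_rel_def)
      finally show ?case by simp
    qed
    then have "\<forall>y\<in>V a b. y \<le> S a b" unfolding V_def by blast
    then show "D a b \<le> S a b" using lub[of a b] unfolding is_lub_def by blast
  qed
  have "C = D"
    unfolding C_def transitive_closure_def using trD RD least by (intro Least_equality) auto
  then show "transitive_rel C" "R \<le> C" "\<And>S. transitive_rel S \<Longrightarrow> R \<le> S \<Longrightarrow> C \<le> S"
    using trD RD least by auto
qed

corollary closure_rel_exists:
  "transitive_rel (closure_rel \<alpha> p A)" "base_rel \<alpha> p A \<le> closure_rel \<alpha> p A"
  "transitive_rel S \<Longrightarrow> base_rel \<alpha> p A \<le> S \<Longrightarrow> closure_rel \<alpha> p A \<le> S"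
  unfolding closure_rel_def by (rule transitive_closure_exists; simp add: base_rel_def)+

text \<open>Words of a crisp automaton.\<close>

lemma lsup_crisp:
  fixes T :: "'l::integral_l_monoid set"
  assumes "T \<subseteq> {0, 1}"
  shows "lsup T = (if 1 \<in> T then 1 else 0)"
  by (rule lsup_eqI) (use assms in \<open>auto simp: is_lub_def zero_least one_greatest\<close>)

lemma delta_star_crisp:
  fixes A :: "('a::finite, 'z, 'l::integral_l_monoid) fuzzy_automaton"
  assumes "nondeterministic A" "u \<in> lists (alphabet A)"
  shows "delta_star A u a b \<in> {0, 1}"
  using assms(2)
proof (induction u arbitrary: b rule: rev_induct)
  case Nil
  then show ?case by (simp add: delta_star_Nil)
next
  case (snoc x u)
  have "delta_star A u a c \<in> {0, 1}" "delta A x c b \<in> {0, 1}" for c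
    using snoc assms(1) by (auto simp: nondeterministic_def)
  then have "delta_star A u a c * delta A x c b \<in> {0, 1}" for c
    by (metis insert_iff mult_1 mult_zero_left singletonD)
  then have "{delta_star A u a c * delta A x c b | c. True} \<subseteq> {0, 1}" by blast
  then show ?case unfolding delta_star_snoc by (simp add: lsup_crisp)
qed

lemma delta_star_snoc_crisp:
  fixes A :: "('a::finite, 'z, 'l::integral_l_monoid) fuzzy_automaton"
  assumes "nondeterministic A" "u @ [x] \<in> lists (alphabet A)" "(0::'l) \<noteq> 1"
  shows "delta_star A (u @ [x]) a b = 1 \<longleftrightarrow>
    (\<exists>c. delta_star A u a c = 1 \<and> delta A x c b = 1)"
proof -
  have cr: "delta_star A u a c \<in> {0, 1}" "delta A x c b \<in> {0, 1}" for c
    using assms delta_star_crisp[OF assms(1), of u] by (auto simp: nondeterministic_def)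
  have "delta_star A u a c * delta A x c b \<in> {0, 1}" for c
    using cr[of c] by auto
  then have "{delta_star A u a c * delta A x c b | c. True} \<subseteq> {0, 1}" by blast
  then have "delta_star A (u @ [x]) a b = 1 \<longleftrightarrow>
      (\<exists>c. delta_star A u a c * delta A x c b = 1)"
    unfolding delta_star_snoc using assms(3) by (auto simp: lsup_crisp split: if_splits)
  also have "\<dots> \<longleftrightarrow> (\<exists>c. delta_star A u a c = 1 \<and> delta A x c b = 1)"
    by (metis assms(3) cr empty_iff insert_iff mult_1 mult_zero_left mult_zero_right)
  finally show ?thesis .
qed

lemma delta_star_append_crisp:
  fixes A :: "('a::finite, 'z, 'l::integral_l_monoid) fuzzy_automaton"
  assumes "nondeterministic A" "u @ v \<in> lists (alphabet A)" "(0::'l) \<noteq> 1"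
  shows "delta_star A (u @ v) a b = 1 \<longleftrightarrow>
    (\<exists>c. delta_star A u a c = 1 \<and> delta_star A v c b = 1)"
  using assms(2)
proof (induction v arbitrary: b rule: rev_induct)
  case Nil
  then show ?case using assms(3) by (auto simp: delta_star_Nil)
next
  case (snoc x v)
  have "delta_star A ((u @ v) @ [x]) a b = 1 \<longleftrightarrow>
      (\<exists>c. delta_star A (u @ v) a c = 1 \<and> delta A x c b = 1)"
    by (rule delta_star_snoc_crisp[OF assms(1) _ assms(3)]) (use snoc in auto)
  moreover have "delta_star A (v @ [x]) d b = 1 \<longleftrightarrow>
      (\<exists>c. delta_star A v d c = 1 \<and> delta A x c b = 1)" for d
    by (rule delta_star_snoc_crisp[OF assms(1) _ assms(3)]) (use snoc in auto)
  ultimately show ?case using snoc by auto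
qed

lemma phi_star_append: "phi_star \<alpha> p (u @ v) = phi_star \<alpha> p u * phi_star \<alpha> p v"
  by (simp add: phi_star_def)

lemma word_shorten:
  fixes A :: "('a::finite, 'z, 'l::integral_l_monoid) fuzzy_automaton"
  assumes "nondeterministic A" "Y \<subseteq> alphabet A" "(0::'l) \<noteq> 1"
    and "v \<in> lists Y" "delta_star A v a b = 1"
  shows "\<exists>w\<in>lists Y. length w < CARD('a) \<and> delta_star A w a b = 1
           \<and> phi_star \<alpha> p v \<le> phi_star \<alpha> p w"
  using assms(4,5)
proof (induction v rule: length_induct)
  case (1 v)
  have Y: "lists Y \<subseteq> lists (alphabet A)" using assms(2) by auto
  show ?case
  proof (cases "length v < CARD('a)")
    case True
    then show ?thesis using 1 by auto
  next
    case False
    have split: "\<exists>c. delta_star A (take i v) a c = 1 \<and> delta_star A (drop i v) c b = 1" for i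
    proof -
      have "take i v @ drop i v \<in> lists (alphabet A)" using 1(2) Y by (simp only: append_take_drop_id) blast
      from delta_star_append_crisp[OF assms(1) this assms(3), of a b] show ?thesis
        using 1(3) unfolding append_take_drop_id by blast
    qed
    then obtain s where s: "\<And>i. delta_star A (take i v) a (s i) = 1"
      "\<And>i. delta_star A (drop i v) (s i) b = 1" by metis
    have "\<not> inj_on s {..length v}"
    proof
      assume "inj_on s {..length v}"
      then have "card {..length v} \<le> CARD('a)" by (intro card_inj_on_le) auto
      then show False using False by simp
    qed
    then obtain i j where ij: "i < j" "j \<le> length v" "s i = s j"
      unfolding inj_on_def by (metis atMost_iff linorder_neqE_nat)
    define w where w: "w = take i v @ drop j v"
    have wY: "w \<in> lists Y" using 1 by (auto simp: w dest: in_set_takeD in_set_dropD)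
    have d: "delta_star A w a b = 1"
      using delta_star_append_crisp[OF assms(1) _ assms(3), of "take i v" "drop j v" a b]
        s(1)[of i] s(2)[of j] ij(3) wY Y unfolding w by auto
    have len: "length w < length v" using ij by (auto simp: w)
    have "v = take i v @ take (j - i) (drop i v) @ drop j v"
      using ij by (metis append.assoc append_take_drop_id le_add_diff_inverse less_imp_le take_add)
    then have "phi_star \<alpha> p v
        = phi_star \<alpha> p (take i v) * (phi_star \<alpha> p (take (j - i) (drop i v)) * phi_star \<alpha> p (drop j v))"
      by (metis phi_star_append)
    also have "\<dots> \<le> phi_star \<alpha> p w"
      unfolding w phi_star_append by (intro mult_mono_lm order_refl mult_le_right)
    finally have le: "phi_star \<alpha> p v \<le> phi_star \<alpha> p w" .
    from 1(1) len wY d obtain w' where "w' \<in> lists Y" "length w' < CARD('a)"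
      "delta_star A w' a b = 1" "phi_star \<alpha> p w \<le> phi_star \<alpha> p w'" by blast
    then show ?thesis using le by (meson order_trans)
  qed
qed

lemma finite_scalars: "finite (scalars \<alpha>)"
  by (induction \<alpha>) auto


text \<open>The suprema that define the transitions and the final vector of the associated automaton.\<close>

lemma assoc_automaton_suprema_exist:
  fixes A :: "('a::finite, 'z, 'l::integral_l_monoid) fuzzy_automaton"
  assumes "associated_alphabet X \<alpha> Y p" "alphabet A = X \<union> Y" "nondeterministic A"
  shows "x \<in> X \<Longrightarrow> is_lub {phi_star \<alpha> p v * delta_star A v a b | v.
                 \<exists>u\<in>lists Y. \<exists>w\<in>lists Y. v = u @ [x] @ w} (delta (assoc_automaton X \<alpha> Y p A) x a b)"
    and "is_lub {lsup {phi_star \<alpha> p v * delta_star A v a b * final A b | b. True} | v.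
                 v \<in> lists Y} (final (assoc_automaton X \<alpha> Y p A) a)"
    and "is_lub {phi_star \<alpha> p v * delta_star A v a b * final A b | b. True}
           (lsup {phi_star \<alpha> p v * delta_star A v a b * final A b | b. True})"
proof -
  define N where "N = {u\<in>lists Y. length u \<le> CARD('a)}"
  have "finite Y"
    using assms(1) finite_scalars bij_betw_finite unfolding associated_alphabet_def by blast
  then have finN: "finite N"
    using finite_lists_length_le[of Y "CARD('a)"] by (simp add: N_def lists_eq_set)
  have emptyN: "[] \<in> N" by (simp add: N_def)
  have YA: "Y \<subseteq> alphabet A" using assms(2) by auto
  have triv: "t = t'" if "(0::'l) = 1" for t t' :: 'l
    using that by (metis mult_1 mult_zero_left)
  have short: "\<exists>w\<in>N. delta_star A w c d = 1 \<and> phi_star \<alpha> p v \<le> phi_star \<alpha> p w"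
    if "(0::'l) \<noteq> 1" "v \<in> lists Y" "delta_star A v c d = 1" for v c d
    using word_shorten[OF assms(3) YA that, of \<alpha> p] by (force simp: N_def)
  show "is_lub {phi_star \<alpha> p v * delta_star A v a b * final A b | b. True}
           (lsup {phi_star \<alpha> p v * delta_star A v a b * final A b | b. True})" for a v
    by (rule is_lub_finite) (simp add: full_SetCompr_eq)
  show "is_lub {phi_star \<alpha> p v * delta_star A v a b | v.
      \<exists>u\<in>lists Y. \<exists>w\<in>lists Y. v = u @ [x] @ w} (delta (assoc_automaton X \<alpha> Y p A) x a b)"
    (is "is_lub ?S _") if x: "x \<in> X"
  proof -
    define f where "f v = phi_star \<alpha> p v * delta_star A v a b" for v
    define T where "T = (\<lambda>(u, w). f (u @ [x] @ w)) ` (N \<times> N)"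
    have "is_lub ?S (lsup ?S)"
    proof (rule is_lub_dominated)
      show "finite T" using finN by (simp add: T_def)
      show "T \<subseteq> ?S" by (auto simp: T_def f_def N_def)
      show "\<exists>t\<in>T. s \<le> t" if sS: "s \<in> ?S" for s
      proof -
        obtain u w where uw: "u \<in> lists Y" "w \<in> lists Y" "s = f (u @ [x] @ w)"
          using sS unfolding f_def by blast
        have ne: "f ([] @ [x] @ []) \<in> T" using emptyN unfolding T_def by force
        have mem: "u @ [x] @ w \<in> lists (alphabet A)" if "u \<in> lists Y" "w \<in> lists Y" for u w
          using that x assms(2) by auto
        show ?thesis
        proof (cases "(0::'l) = 1 \<or> s = 0")
          case True
          then show ?thesis using ne triv zero_least by (metis order_refl)
        next
          case False
          have "delta_star A (u @ [x] @ w) a b \<in> {0, 1}"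
            using delta_star_crisp[OF assms(3) mem[OF uw(1,2)]] .
          then have one: "delta_star A (u @ [x] @ w) a b = 1"
            using False uw(3) by (auto simp: f_def)
          have mem': "[x] @ w \<in> lists (alphabet A)" using mem[of "[]" w] uw by auto
          obtain c d where cd: "delta_star A u a c = 1" "delta_star A [x] c d = 1"
              "delta_star A w d b = 1"
            using one delta_star_append_crisp[OF assms(3) mem[OF uw(1,2)]]
              delta_star_append_crisp[OF assms(3) mem'] False by blast
          obtain u' where u': "u' \<in> N" "delta_star A u' a c = 1" "phi_star \<alpha> p u \<le> phi_star \<alpha> p u'"
            using short uw(1) cd(1) False by blast
          obtain w' where w': "w' \<in> N" "delta_star A w' d b = 1" "phi_star \<alpha> p w \<le> phi_star \<alpha> p w'"
            using short uw(2) cd(3) False by blast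
          have Y': "u' \<in> lists Y" "w' \<in> lists Y" using u' w' by (auto simp: N_def)
          have mem'': "[x] @ w' \<in> lists (alphabet A)" using mem[of "[]" w'] Y' by auto
          have "delta_star A (u' @ [x] @ w') a b = 1"
            using u'(2) w'(2) cd(2) delta_star_append_crisp[OF assms(3) mem[OF Y']]
              delta_star_append_crisp[OF assms(3) mem''] False by blast
          then have "s \<le> f (u' @ [x] @ w')"
            unfolding uw(3) f_def one phi_star_append
            using u'(3) w'(3) by (simp add: mult_mono_lm)
          then show ?thesis using u'(1) w'(1) by (force simp: T_def)
        qed
      qed
    qed
    then show ?thesis by (simp add: assoc_automaton_def)
  qed
  show "is_lub {lsup {phi_star \<alpha> p v * delta_star A v a b * final A b | b. True} | v.
      v \<in> lists Y} (final (assoc_automaton X \<alpha> Y p A) a)"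
    (is "is_lub ?S _")
  proof -
    define g where "g v b = phi_star \<alpha> p v * delta_star A v a b * final A b" for v b
    define h where "h v = lsup (range (g v))" for v
    have S: "?S = h ` lists Y" by (auto simp: h_def g_def full_SetCompr_eq)
    define V where "V = {g v b | v b. v \<in> lists Y}"
    define T where "T = (\<lambda>(v, b). g v b) ` (N \<times> UNIV)"
    have lubh: "is_lub (range (g v)) (h v)" for v
      unfolding h_def by (rule is_lub_finite) simp
    have "is_lub V (lsup V)"
    proof (rule is_lub_dominated)
      show "finite T" using finN by (simp add: T_def)
      show "T \<subseteq> V" by (auto simp: T_def V_def N_def)
      show "\<exists>t\<in>T. s \<le> t" if sV: "s \<in> V" for s
      proof -
        obtain v b where v: "v \<in> lists Y" "s = g v b" using sV by (auto simp: V_def)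
        have ne: "g [] b \<in> T" using emptyN unfolding T_def by force
        show ?thesis
        proof (cases "(0::'l) = 1 \<or> s = 0")
          case True
          then show ?thesis using ne triv zero_least by (metis order_refl)
        next
          case False
          have "v \<in> lists (alphabet A)" using v(1) YA by auto
          then have "delta_star A v a b \<in> {0, 1}" by (rule delta_star_crisp[OF assms(3)])
          then have one: "delta_star A v a b = 1" using False v(2) by (auto simp: g_def)
          obtain w where w: "w \<in> N" "delta_star A w a b = 1" "phi_star \<alpha> p v \<le> phi_star \<alpha> p w"
            using short v(1) one False by blast
          then have "s \<le> g w b" unfolding v(2) g_def one w(2) by (intro mult_mono_lm) auto
          then show ?thesis using w(1) by (force simp: T_def)
        qed
      qed
    qed
    then have V: "g v b \<le> lsup V" "\<And>t. (\<And>v b. v \<in> lists Y \<Longrightarrow> g v b \<le> t) \<Longrightarrow> lsup V \<le> t"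
      if "v \<in> lists Y" for v b
      using that unfolding is_lub_def V_def by blast+
    have "h v \<le> lsup V" if "v \<in> lists Y" for v
      using lubh[of v] V(1)[OF that] unfolding is_lub_def by blast
    moreover have "lsup V \<le> t" if t: "\<And>v. v \<in> lists Y \<Longrightarrow> h v \<le> t" for t
    proof (rule V(2)[of "[]"])
      fix v b assume v: "v \<in> lists Y"
      have "g v b \<le> h v" using lubh[of v] by (simp add: is_lub_def)
      then show "g v b \<le> t" using t[OF v] by (rule order_trans)
    qed simp
    ultimately have "is_lub ?S (lsup V)"
      unfolding S is_lub_def by blast
    moreover have "final (assoc_automaton X \<alpha> Y p A) a = lsup ?S"
      by (simp add: assoc_automaton_def)
    ultimately show ?thesis by (simp only: lsup_eqI)
  qed
qed

end

theory Submission
  imports Defs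
begin

text \<open>
  The value \<open>phi_star \<alpha> p v * delta_star A v a b\<close> of a word \<open>v\<close> over \<open>Y\<close>, from \<open>a\<close> to \<open>b\<close>, is
  multiplicative along state sequences because the crisp factor commutes with all scalars. Hence
  the supremum of these values over all such words is a transitive fuzzy relation containing
  \<open>base_rel\<close>, while each single value lies below every transitive relation containing \<open>base_rel\<close>;
  so this supremum is \<open>closure_rel\<close>. In an integral l-monoid multiplication need not distribute
  over infinite suprema, but by pumping the supremum over \<open>lists Y\<close> is attained by finitely many
  words. Cutting words of \<open>Y\<^sup>*xY\<^sup>*\<close> at the letter \<open>x\<close>, whose value under \<open>phi\<close> is \<open>1\<close>, then
  yields both identities.
\<close>

section \<open>Finite suprema and compositions of fuzzy relations\<close>

lemma lsup_le_iff:
  fixes T :: "'l::integral_l_monoid set"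
  assumes "finite T"
  shows "lsup T \<le> u \<longleftrightarrow> (\<forall>t\<in>T. t \<le> u)"
  using is_lub_finite[OF assms] unfolding is_lub_def by (meson order_trans)

lemma rel_comp_le_iff:
  fixes R S :: "('a::finite, 'l::integral_l_monoid) frel"
  shows "(R \<odot> S) a b \<le> u \<longleftrightarrow> (\<forall>c. R a c * S c b \<le> u)"
  unfolding rel_comp_def by (subst lsup_le_iff) (auto simp: full_SetCompr_eq)

lemma rel_app_le_iff:
  fixes R :: "('a::finite, 'l::integral_l_monoid) frel"
  shows "(R \<odot>\<^sub>v f) a \<le> u \<longleftrightarrow> (\<forall>b. R a b * f b \<le> u)"
  unfolding rel_app_def by (subst lsup_le_iff) (auto simp: full_SetCompr_eq)

lemma rel_comp_upper:
  fixes R S :: "('a::finite, 'l::integral_l_monoid) frel"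
  shows "R a c * S c b \<le> (R \<odot> S) a b"
  using rel_comp_le_iff[of R S a b] by blast

lemma rel_app_upper:
  fixes R :: "('a::finite, 'l::integral_l_monoid) frel"
  shows "R a b * f b \<le> (R \<odot>\<^sub>v f) a"
  using rel_app_le_iff[of R f a] by blast

text \<open>For a composition that is itself the left factor of a product, where
  \<open>rel_comp_le_iff\<close> does not apply.\<close>

lemma rel_comp_mult_le:
  fixes R S :: "('a::finite, 'l::integral_l_monoid) frel"
  assumes "\<And>c. R a c * S c b * z \<le> u"
  shows "(R \<odot> S) a b * z \<le> u"
  unfolding rel_comp_def by (rule lsup_mult_le) (auto simp: full_SetCompr_eq assms)

lemma delta_star_single:
  fixes A :: "('a::finite, 'z, 'l::integral_l_monoid) fuzzy_automaton"
  shows "delta_star A [x] = delta A x"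
proof (intro ext order_antisym)
  have comp: "delta_star A [x] = id_rel \<odot> delta A x"
    by (simp add: delta_star_def)
  fix a b
  show "delta_star A [x] a b \<le> delta A x a b"
    by (simp add: comp rel_comp_le_iff id_rel_def zero_least)
  show "delta A x a b \<le> delta_star A [x] a b"
    using rel_comp_upper[of id_rel a a "delta A x" b] by (simp add: comp id_rel_def)
qed

text \<open>With \<open>0 \<noteq> 1\<close>, the value 1 of a word means that a run exists, as the
  concatenation and shortening lemmas for crisp automata assume. The degenerate case is settled in
  the theorem.\<close>

locale crisp_assoc_automaton =
  fixes X Y :: "'z set"
    and \<alpha> :: "('l::integral_l_monoid, 'z) fuzzy_rexp"
    and p :: "'l \<Rightarrow> 'z"
    and A :: "('a::finite, 'z, 'l) fuzzy_automaton"
  assumes assoc: "associated_alphabet X \<alpha> Y p"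
    and alphabet: "alphabet A = X \<union> Y"
    and crisp: "nondeterministic A"
    and nontrivial: "(0::'l) \<noteq> 1"
begin

section \<open>Weights of words and their supremum over \<open>lists Y\<close>\<close>

definition weight :: "'z list \<Rightarrow> ('a, 'l) frel" where
  "weight v a b = phi_star \<alpha> p v * delta_star A v a b"

text \<open>A supremum over a possibly infinite set; that it exists in a lattice that need not be
  complete is part of \<open>reach_finite\<close>.\<close>

definition reach :: "('a, 'l) frel" where
  "reach a b = lsup {weight v a b | v. v \<in> lists Y}"

lemma lists_Y_subset: "lists Y \<subseteq> lists (alphabet A)"
  using alphabet by auto

lemma phi_letter:
  assumes "l \<in> scalars \<alpha>"
  shows "phi \<alpha> p (p l) = l"
  using assms assoc
  by (auto simp: phi_def associated_alphabet_def bij_betw_def the_inv_into_f_f)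

lemma phi_outside:
  assumes "x \<in> X"
  shows "phi \<alpha> p x = 1"
  using assms assoc by (auto simp: phi_def associated_alphabet_def bij_betw_def)

lemma weight_Nil: "weight [] a a = 1"
  by (simp add: weight_def phi_star_def delta_star_Nil)

lemma weight_single: "weight [z] a b = phi \<alpha> p z * delta A z a b"
  by (simp add: weight_def phi_star_def delta_star_single)

lemma weight_crisp_cases:
  assumes "v \<in> lists (alphabet A)"
  obtains "delta_star A v a b = 0" "weight v a b = 0"
  | "delta_star A v a b = 1" "weight v a b = phi_star \<alpha> p v"
  using delta_star_crisp[OF crisp assms, of a b] by (auto simp: weight_def)

text \<open>Multiplication need not commute, but the crisp factor standing between the two
  \<open>phi_star\<close> values is 0 or 1 and drops out. Equality can fail, since a run on
  \<open>u @ v\<close> may pass through a state other than \<open>c\<close>.\<close>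

lemma weight_append_ge:
  assumes "u @ v \<in> lists (alphabet A)"
  shows "weight u a c * weight v c b \<le> weight (u @ v) a b"
proof -
  have uv: "u \<in> lists (alphabet A)" "v \<in> lists (alphabet A)"
    using assms by auto
  show ?thesis
  proof (cases "weight u a c = 0 \<or> weight v c b = 0")
    case True
    then show ?thesis by (auto simp: zero_least)
  next
    case False
    then have "delta_star A u a c = 1" "delta_star A v c b = 1"
      using delta_star_crisp[OF crisp uv(1), of a c] delta_star_crisp[OF crisp uv(2), of c b]
      by (auto simp: weight_def)
    moreover from this have "delta_star A (u @ v) a b = 1"
      using delta_star_append_crisp[OF crisp assms nontrivial] by blast
    ultimately show ?thesis
      by (simp add: weight_def phi_star_append)
  qed
qed

text \<open>A crisp run splits at an actual state, so one \<open>c\<close> does the work of a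
  supremum over all states.\<close>

lemma weight_append_le:
  assumes "u @ v \<in> lists (alphabet A)"
  shows "\<exists>c. weight (u @ v) a b \<le> weight u a c * weight v c b"
proof (rule weight_crisp_cases[OF assms, of a b])
  assume "weight (u @ v) a b = 0"
  then show ?thesis by (simp add: zero_least)
next
  assume *: "delta_star A (u @ v) a b = 1" "weight (u @ v) a b = phi_star \<alpha> p (u @ v)"
  then obtain c where "delta_star A u a c = 1" "delta_star A v c b = 1"
    using delta_star_append_crisp[OF crisp assms nontrivial] by blast
  then have "weight (u @ v) a b = weight u a c * weight v c b"
    using *(2) by (simp add: weight_def phi_star_append)
  then show ?thesis by (metis order_refl)
qed

text \<open>Cutting loops out of a run keeps its endpoints and, since the unit is the greatest
  element, does not decrease \<open>phi_star\<close>. Hence words of bounded length dominate all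
  others.\<close>

lemma reach_finite:
  obtains T where "finite T" "T \<subseteq> {weight v a b | v. v \<in> lists Y}"
    "reach a b = lsup T" "is_lub {weight v a b | v. v \<in> lists Y} (reach a b)"
proof -
  define T where "T = (\<lambda>v. weight v a b) ` {v \<in> lists Y. length v \<le> CARD('a)}"
  have "finite Y"
    using assoc finite_scalars bij_betw_finite unfolding associated_alphabet_def by blast
  then have fin: "finite T"
    using finite_lists_length_le[of Y "CARD('a)"] by (simp add: T_def lists_eq_set)
  have sub: "T \<subseteq> {weight v a b | v. v \<in> lists Y}"
    by (auto simp: T_def)
  have dom: "\<exists>t\<in>T. s \<le> t" if "s \<in> {weight v a b | v. v \<in> lists Y}" for s
  proof -
    from that obtain v where v: "v \<in> lists Y" "s = weight v a b" by blast
    then have "v \<in> lists (alphabet A)" using lists_Y_subset by blast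
    then show ?thesis
    proof (cases rule: weight_crisp_cases[of v a b])
      case 1
      \<comment> \<open>The empty word supplies a member of \<open>T\<close> above the value
        0.\<close>
      moreover have "weight [] a b \<in> T" by (simp add: T_def)
      ultimately show ?thesis using v(2) zero_least by metis
    next
      case 2
      have "Y \<subseteq> alphabet A" using alphabet by simp
      from word_shorten[OF crisp this nontrivial v(1) 2(1), of \<alpha> p]
      obtain w where "w \<in> lists Y" "length w < CARD('a)" "s \<le> weight w a b"
        using 2(2) v(2) unfolding weight_def by (metis mult_1_right)
      then show ?thesis by (auto simp: T_def intro!: bexI[of _ "weight w a b"])
    qed
  qed
  show ?thesis
    by (rule that[OF fin sub]) (use is_lub_dominated[OF fin sub dom] in \<open>simp_all add: reach_def\<close>)
qed

lemma weight_le_reach: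
  assumes "v \<in> lists Y"
  shows "weight v a b \<le> reach a b"
proof (rule reach_finite[of a b])
  assume "is_lub {weight v a b | v. v \<in> lists Y} (reach a b)"
  then show ?thesis using assms unfolding is_lub_def by blast
qed

text \<open>Stands in for distributivity over an infinite supremum: only the finite set
  \<open>T\<close> has to be distributed over.\<close>

lemma reach_mult_le:
  assumes "\<And>v. v \<in> lists Y \<Longrightarrow> weight v a b * z \<le> u"
  shows "reach a b * z \<le> u"
proof (rule reach_finite[of a b])
  fix T
  assume "finite T" "T \<subseteq> {weight v a b | v. v \<in> lists Y}" "reach a b = lsup T"
  then show ?thesis using assms by (auto intro!: lsup_mult_le)
qed

lemma mult_reach_le:
  assumes "\<And>v. v \<in> lists Y \<Longrightarrow> z * weight v a b \<le> u"
  shows "z * reach a b \<le> u"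
proof (rule reach_finite[of a b])
  fix T
  assume "finite T" "T \<subseteq> {weight v a b | v. v \<in> lists Y}" "reach a b = lsup T"
  then show ?thesis using assms by (auto intro!: mult_lsup_le)
qed

section \<open>Identification of \<open>reach\<close> with the transitive closure\<close>

lemma weight_letter_le_base_rel:
  assumes "y \<in> Y"
  shows "weight [y] a b \<le> base_rel \<alpha> p A a b"
proof (cases "a = b")
  case True
  then show ?thesis by (simp add: base_rel_def one_greatest)
next
  case False
  obtain l where l: "l \<in> scalars \<alpha>" "y = p l"
    using assms assoc by (auto simp: associated_alphabet_def bij_betw_def)
  have "finite {l * delta A (p l) a b | l. l \<in> scalars \<alpha>}"
    using finite_scalars by simp
  from lsup_le_iff[OF this] have "l * delta A (p l) a b \<le> base_rel \<alpha> p A a b"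
    using False l(1) by (auto simp: base_rel_def)
  then show ?thesis using l by (simp add: weight_single phi_letter)
qed

lemma weight_le_closure_rel:
  assumes "v \<in> lists Y"
  shows "weight v a b \<le> closure_rel \<alpha> p A a b"
  using assms
proof (induction v arbitrary: b rule: rev_induct)
  case Nil
  \<comment> \<open>The diagonal value 1 of \<open>base_rel\<close> covers the empty word, whose
    weight off the diagonal is 0.\<close>
  have "base_rel \<alpha> p A a a \<le> closure_rel \<alpha> p A a a"
    using closure_rel_exists(2) by (rule le_funD[THEN le_funD])
  then show ?case
    by (auto simp: weight_def phi_star_def delta_star_Nil base_rel_def zero_least)
next
  case (snoc y v)
  then have "v @ [y] \<in> lists (alphabet A)" using lists_Y_subset by blast
  then obtain c where "weight (v @ [y]) a b \<le> weight v a c * weight [y] c b"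
    using weight_append_le by blast
  also have "\<dots> \<le> closure_rel \<alpha> p A a c * base_rel \<alpha> p A c b"
    using snoc by (intro mult_mono_lm weight_letter_le_base_rel) auto
  also have "\<dots> \<le> closure_rel \<alpha> p A a c * closure_rel \<alpha> p A c b"
    by (intro mult_mono_lm order_refl closure_rel_exists(2)[THEN le_funD, THEN le_funD])
  also have "\<dots> \<le> closure_rel \<alpha> p A a b"
    using closure_rel_exists(1) unfolding transitive_rel_def by blast
  finally show ?case .
qed

lemma transitive_reach: "transitive_rel reach"
  unfolding transitive_rel_def
proof (intro allI reach_mult_le mult_reach_le)
  fix a b c u v
  assume uv: "u \<in> lists Y" "v \<in> lists Y"
  then have "u @ v \<in> lists Y" by auto
  then show "weight u a b * weight v b c \<le> reach a c"
    using weight_append_ge weight_le_reach lists_Y_subset by (meson order_trans subsetD)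
qed

lemma base_rel_le_reach: "base_rel \<alpha> p A \<le> reach"
proof (intro le_funI)
  fix a b
  show "base_rel \<alpha> p A a b \<le> reach a b"
  proof (cases "a = b")
    case True
    then show ?thesis
      using weight_le_reach[of "[]" a a] by (simp add: base_rel_def weight_Nil)
  next
    case False
    have "l * delta A (p l) a b \<le> reach a b" if "l \<in> scalars \<alpha>" for l
    proof -
      have "[p l] \<in> lists Y"
        using that assoc by (auto simp: associated_alphabet_def bij_betw_def)
      from weight_le_reach[OF this, of a b] show ?thesis
        using that by (simp add: weight_single phi_letter)
    qed
    then show ?thesis
      using False finite_scalars by (auto simp: base_rel_def lsup_le_iff)
  qed
qed

lemma closure_rel_eq_reach: "closure_rel \<alpha> p A = reach"
proof (rule order_antisym)
  show "closure_rel \<alpha> p A \<le> reach"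
    using closure_rel_exists(3) transitive_reach base_rel_le_reach by blast
  show "reach \<le> closure_rel \<alpha> p A"
    \<comment> \<open>With \<open>z = 1\<close> the rule becomes the least upper bound property of
      \<open>reach\<close>.\<close>
    using reach_mult_le[where z = 1] weight_le_closure_rel by (intro le_funI) auto
qed

section \<open>Transitions and final vector of the associated automaton\<close>

lemma delta_assoc_automaton:
  assumes "x \<in> X"
  shows "delta (assoc_automaton X \<alpha> Y p A) x = reach \<odot> delta A x \<odot> reach"
proof (intro ext)
  fix a b
  let ?V = "{phi_star \<alpha> p v * delta_star A v a b | v.
                 \<exists>u\<in>lists Y. \<exists>w\<in>lists Y. v = u @ [x] @ w}"
  have V: "?V = {weight (u @ [x] @ w) a b | u w. u \<in> lists Y \<and> w \<in> lists Y}"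
    by (auto simp: weight_def)
  have words: "u @ [x] @ w \<in> lists (alphabet A)" "[x] @ w \<in> lists (alphabet A)"
    if "u \<in> lists Y" "w \<in> lists Y" for u w
    using that assms alphabet by auto
  have x: "weight [x] = delta A x"
    by (intro ext) (simp add: weight_single phi_outside[OF assms])
  \<comment> \<open>Upper bound: \<open>c\<close> and \<open>d\<close> are the states just before
    and just after \<open>x\<close> on a run.\<close>
  have "weight (u @ [x] @ w) a b \<le> (reach \<odot> delta A x \<odot> reach) a b"
    if uw: "u \<in> lists Y" "w \<in> lists Y" for u w
  proof -
    obtain c where c: "weight (u @ [x] @ w) a b \<le> weight u a c * weight ([x] @ w) c b"
      using weight_append_le words(1)[OF uw] by blast
    obtain d where d: "weight ([x] @ w) c b \<le> delta A x c d * weight w d b"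
      using weight_append_le words(2)[OF uw] x by metis
    have "weight (u @ [x] @ w) a b \<le> weight u a c * (delta A x c d * weight w d b)"
      using c mult_mono_lm[OF order_refl d] by (rule order_trans)
    also have "\<dots> \<le> reach a c * delta A x c d * reach d b"
      unfolding mult.assoc by (intro mult_mono_lm order_refl weight_le_reach uw)
    also have "\<dots> \<le> (reach \<odot> delta A x) a d * reach d b"
      by (intro mult_mono_lm order_refl rel_comp_upper)
    also have "\<dots> \<le> (reach \<odot> delta A x \<odot> reach) a b"
      by (rule rel_comp_upper)
    finally show ?thesis .
  qed
  moreover have "(reach \<odot> delta A x \<odot> reach) a b \<le> t"
    if t: "\<And>u w. u \<in> lists Y \<Longrightarrow> w \<in> lists Y \<Longrightarrow> weight (u @ [x] @ w) a b \<le> t" for t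
  proof -
    \<comment> \<open>The two factors \<open>reach\<close> are replaced by single words in turn,
      each time rebracketed to stand at an end of the product.\<close>
    have "reach a c * (delta A x c d * reach d b) \<le> t" for c d
    proof (rule reach_mult_le)
      fix u
      assume u: "u \<in> lists Y"
      have "weight u a c * delta A x c d * reach d b \<le> t"
      proof (rule mult_reach_le)
        fix w
        assume w: "w \<in> lists Y"
        have "weight u a c * (weight [x] c d * weight w d b) \<le> weight u a c * weight ([x] @ w) c b"
          by (intro mult_mono_lm order_refl weight_append_ge words(2)[OF u w])
        also have "\<dots> \<le> weight (u @ [x] @ w) a b"
          by (intro weight_append_ge words(1)[OF u w])
        also have "\<dots> \<le> t" by (rule t[OF u w])
        finally show "weight u a c * delta A x c d * weight w d b \<le> t"
          by (simp add: x mult.assoc)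
      qed
      then show "weight u a c * (delta A x c d * reach d b) \<le> t"
        by (simp add: mult.assoc)
    qed
    then show ?thesis
      unfolding rel_comp_le_iff[of "reach \<odot> delta A x"]
      by (intro allI rel_comp_mult_le) (simp add: mult.assoc)
  qed
  ultimately have "is_lub ?V ((reach \<odot> delta A x \<odot> reach) a b)"
    unfolding V is_lub_def by blast
  then show "delta (assoc_automaton X \<alpha> Y p A) x a b = (reach \<odot> delta A x \<odot> reach) a b"
    by (simp add: assoc_automaton_def lsup_eqI)
qed

text \<open>The inner suprema run over finitely many states, so they are bounded summand by summand.
  This exchanges the two suprema, and \<open>reach_mult_le\<close> passes from words to
  \<open>reach\<close>.\<close>

lemma final_assoc_automaton:
  "final (assoc_automaton X \<alpha> Y p A) = reach \<odot>\<^sub>v final A"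
proof (intro ext)
  fix a
  let ?V = "{lsup {phi_star \<alpha> p v * delta_star A v a b * final A b | b. True} | v. v \<in> lists Y}"
  have V: "?V = {(weight v \<odot>\<^sub>v final A) a | v. v \<in> lists Y}"
    by (simp add: weight_def rel_app_def)
  have "(weight v \<odot>\<^sub>v final A) a \<le> (reach \<odot>\<^sub>v final A) a" if "v \<in> lists Y" for v
    unfolding rel_app_le_iff[of "weight v"]
    using mult_mono_lm[OF weight_le_reach[OF that] order_refl] rel_app_upper
    by (meson order_trans)
  moreover have "(reach \<odot>\<^sub>v final A) a \<le> t"
    if "\<And>v. v \<in> lists Y \<Longrightarrow> (weight v \<odot>\<^sub>v final A) a \<le> t" for t
    using that unfolding rel_app_le_iff by (intro allI reach_mult_le) blast
  ultimately have "is_lub ?V ((reach \<odot>\<^sub>v final A) a)"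
    unfolding V is_lub_def by blast
  then show "final (assoc_automaton X \<alpha> Y p A) a = (reach \<odot>\<^sub>v final A) a"
    by (simp add: assoc_automaton_def lsup_eqI)
qed

end

theorem theorem4p4:
  fixes X Y :: "'z set"
    and \<alpha> :: "('l::integral_l_monoid, 'z) fuzzy_rexp"
    and p :: "'l \<Rightarrow> 'z"
    and A :: "('a::finite, 'z, 'l) fuzzy_automaton"
  assumes "finite X"
    and "letters \<alpha> \<subseteq> X"
    and "associated_alphabet X \<alpha> Y p"
    and "alphabet A = X \<union> Y"
    and "nondeterministic A"
    and "recognizes A (char_lang (rexp_of p \<alpha>))"
  shows "(\<forall>x\<in>X. delta (assoc_automaton X \<alpha> Y p A) x
                   = closure_rel \<alpha> p A \<odot> delta A x \<odot> closure_rel \<alpha> p A)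
       \<and> final (assoc_automaton X \<alpha> Y p A) = closure_rel \<alpha> p A \<odot>\<^sub>v final A"
proof (cases "(0::'l) = 1")
  case True
  \<comment> \<open>Each element equals \<open>1 * s = 0 * s = 0\<close>, so any two fuzzy relations
    coincide.\<close>
  then have "s = t" for s t :: 'l
    by (metis mult_1 mult_zero_left)
  then show ?thesis by blast
next
  case False
  then interpret crisp_assoc_automaton X Y \<alpha> p A
    using assms by unfold_locales
  show ?thesis
    by (simp add: closure_rel_eq_reach delta_assoc_automaton final_assoc_automaton)
qed

end
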